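(* There is no odd-quadratic Lie superalgebra $(\mathfrak g=\mathfrak g_{\bar 0}\oplus\mathfrak g_{\bar 1},[\cdot,\cdot],B)$ such that the $\mathfrak g_{\bar 0}$-module $\mathfrak g_{\bar 1}$ is filiform and $\dim\mathfrak g_{\bar 0}\ge 2$.
   Context: All Lie (super)algebras and modules are finite-dimensional over an algebraically closed field $\mathbb K$ of characteristic zero. A Lie superalgebra $\mathfrak g=\mathfrak g_{\bar 0}\oplus\mathfrak g_{\bar 1}$ is odd-quadratic, written $(\mathfrak g,B)$ or $(\mathfrak g,[\cdot,\cdot],B)$, if it carries a bilinear form $B:\mathfrak g\times\mathfrak g\to\mathbb K$ that is supersymmetric ($B(X,Y)=(-1)^{ij}B(Y,X)$ for $X\in\mathfrak g_{\bar i},Y\in\mathfrak g_{\bar j}$), invariant ($B([X,Y],Z)=B(X,[Y,Z])$), odd ($B(\mathfrak g_{\bar 0},\mathfrak g_{\bar 0})=B(\mathfrak g_{\bar 1},\mathfrak g_{\bar 1})=0$) and non-degenerate. The odd part $\mathfrak g_{\bar 1}$ is a $\mathfrak g_{\bar 0}$-module via the bracket. For a Lie algebra $\mathfrak a$, an $\mathfrak a$-module $V$ of dimension $m$ is filiform if there are submodules $V=V_m\supset V_{m-1}\supset\cdots\supset V_1\supset V_0=\{0\}$ with $\dim V_i=i$ for $0\le i\le m$ and $\mathfrak a\cdot V_i=V_{i-1}$ for $1\le i\le m$, where $\mathfrak a\cdot V_i$ is the linear span of the elements $x\cdot v$, $x\in\mathfrak a$, $v\in V_i$. *)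

theory Defs
  imports "HOL-Library.Z2" "HOL-Computational_Algebra.Polynomial"
begin

text \<open>
  Lie algebras and their modules are given on subspaces \<open>L\<close> and \<open>M\<close> of ambient vector spaces,
  so that the homogeneous parts of a Lie superalgebra are instances.  Operations are
  unconstrained off these subspaces.
\<close>

locale lie_algebra = vector_space scale
  for scale :: "'k::field \<Rightarrow> 'a::ab_group_add \<Rightarrow> 'a" +
  fixes L :: "'a set"
    and bracket :: "'a \<Rightarrow> 'a \<Rightarrow> 'a"
  assumes subspace_carrier: "subspace L"
    and finite_dim_carrier: "\<exists>S. finite S \<and> L \<subseteq> span S"
    and bracket_closed: "x \<in> L \<Longrightarrow> y \<in> L \<Longrightarrow> bracket x y \<in> L"
    and bracket_add_left:
      "x \<in> L \<Longrightarrow> y \<in> L \<Longrightarrow> z \<in> L \<Longrightarrow> bracket (x + y) z = bracket x z + bracket y z"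
    and bracket_add_right:
      "x \<in> L \<Longrightarrow> y \<in> L \<Longrightarrow> z \<in> L \<Longrightarrow> bracket x (y + z) = bracket x y + bracket x z"
    and bracket_scale_left:
      "x \<in> L \<Longrightarrow> y \<in> L \<Longrightarrow> bracket (scale c x) y = scale c (bracket x y)"
    and bracket_scale_right:
      "x \<in> L \<Longrightarrow> y \<in> L \<Longrightarrow> bracket x (scale c y) = scale c (bracket x y)"
    and alternating: "x \<in> L \<Longrightarrow> bracket x x = 0"
    and jacobi: "x \<in> L \<Longrightarrow> y \<in> L \<Longrightarrow> z \<in> L \<Longrightarrow>
      bracket x (bracket y z) + bracket y (bracket z x) + bracket z (bracket x y) = 0"

locale lie_module = A: lie_algebra scaleA L bracket + V: vector_space scaleV
  for scaleA :: "'k::field \<Rightarrow> 'a::ab_group_add \<Rightarrow> 'a"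
    and L :: "'a set"
    and bracket :: "'a \<Rightarrow> 'a \<Rightarrow> 'a"
    and scaleV :: "'k \<Rightarrow> 'v::ab_group_add \<Rightarrow> 'v" +
  fixes M :: "'v set"
    and act :: "'a \<Rightarrow> 'v \<Rightarrow> 'v"
  assumes subspace_module: "V.subspace M"
    and finite_dim_module: "\<exists>S. finite S \<and> M \<subseteq> V.span S"
    and act_closed: "x \<in> L \<Longrightarrow> v \<in> M \<Longrightarrow> act x v \<in> M"
    and act_add_left:
      "x \<in> L \<Longrightarrow> y \<in> L \<Longrightarrow> v \<in> M \<Longrightarrow> act (x + y) v = act x v + act y v"
    and act_add_right:
      "x \<in> L \<Longrightarrow> v \<in> M \<Longrightarrow> w \<in> M \<Longrightarrow> act x (v + w) = act x v + act x w"
    and act_scale_left: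
      "x \<in> L \<Longrightarrow> v \<in> M \<Longrightarrow> act (scaleA c x) v = scaleV c (act x v)"
    and act_scale_right:
      "x \<in> L \<Longrightarrow> v \<in> M \<Longrightarrow> act x (scaleV c v) = scaleV c (act x v)"
    and act_bracket: "x \<in> L \<Longrightarrow> y \<in> L \<Longrightarrow> v \<in> M \<Longrightarrow>
      act (bracket x y) v = act x (act y v) - act y (act x v)"
begin

definition submodule :: "'v set \<Rightarrow> bool" where
  "submodule W \<longleftrightarrow> V.subspace W \<and> W \<subseteq> M \<and> (\<forall>x\<in>L. \<forall>w\<in>W. act x w \<in> W)"

definition act_span :: "'v set \<Rightarrow> 'v set" where
  "act_span W = V.span {act x w | x w. x \<in> L \<and> w \<in> W}"

definition filiform :: bool where
  "filiform \<longleftrightarrow> (\<exists>W :: nat \<Rightarrow> 'v set.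
     W (V.dim M) = M \<and> W 0 = {0} \<and>
     (\<forall>i \<le> V.dim M. submodule (W i) \<and> V.dim (W i) = i) \<and>
     (\<forall>i \<in> {1..V.dim M}. W (i - 1) \<subset> W i \<and> act_span (W i) = W (i - 1)))"

end

definition koszul_sign :: "bit \<Rightarrow> bit \<Rightarrow> 'k::field" where
  "koszul_sign i j = (if i = 1 \<and> j = 1 then - 1 else 1)"

text \<open>The homogeneous part of degree \<open>i \<in> \<int>/2\<close> is \<open>g i\<close>, and the whole space is the type \<open>'v\<close>.\<close>

locale lie_superalgebra = vector_space scale
  for scale :: "'k::field_char_0 \<Rightarrow> 'v::ab_group_add \<Rightarrow> 'v" +
  fixes g :: "bit \<Rightarrow> 'v set"
    and bracket :: "'v \<Rightarrow> 'v \<Rightarrow> 'v"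
  assumes finite_dim: "\<exists>S. finite S \<and> span S = UNIV"
    and subspace_part: "subspace (g i)"
    and parts_disjoint: "g 0 \<inter> g 1 = {0}"
    and parts_sum: "\<exists>x\<in>g 0. \<exists>y\<in>g 1. v = x + y"
    and bracket_linear_left: "Vector_Spaces.linear scale scale (\<lambda>x. bracket x y)"
    and bracket_linear_right: "Vector_Spaces.linear scale scale (bracket x)"
    and bracket_graded: "x \<in> g i \<Longrightarrow> y \<in> g j \<Longrightarrow> bracket x y \<in> g (i + j)"
    and super_skew: "x \<in> g i \<Longrightarrow> y \<in> g j \<Longrightarrow>
      bracket x y = - scale (koszul_sign i j) (bracket y x)"
    and super_jacobi: "x \<in> g i \<Longrightarrow> y \<in> g j \<Longrightarrow> z \<in> g k \<Longrightarrow>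
      bracket x (bracket y z) =
        bracket (bracket x y) z + scale (koszul_sign i j) (bracket y (bracket x z))"
begin

lemmas bracket_hom_left = bracket_linear_left[unfolded module_hom_iff_linear[symmetric]]
  and bracket_hom_right = bracket_linear_right[unfolded module_hom_iff_linear[symmetric]]

sublocale even_part: lie_algebra scale "g 0" bracket
proof
  show "\<exists>S. finite S \<and> g 0 \<subseteq> span S"
    using finite_dim by auto
  have skew: "bracket x y = - bracket y x" if "x \<in> g 0" "y \<in> g 0" for x y
    using super_skew[OF that] by (simp add: koszul_sign_def)
  show "bracket x x = 0" if x: "x \<in> g 0" for x
  proof -
    have "scale 2 (bracket x x) = bracket x x + bracket x x"
      using scale_left_distrib[of 1 1 "bracket x x"] by simp
    also have "\<dots> = 0"
      using skew[OF x x] by (metis add.right_inverse)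
    finally show ?thesis
      by simp
  qed
  show closed: "bracket x y \<in> g 0" if "x \<in> g 0" "y \<in> g 0" for x y
    using bracket_graded[OF that] by simp
  show "bracket x (bracket y z) + bracket y (bracket z x) + bracket z (bracket x y) = 0"
    if x: "x \<in> g 0" and y: "y \<in> g 0" and z: "z \<in> g 0" for x y z
  proof -
    have "bracket x (bracket y z) = bracket (bracket x y) z + bracket y (bracket x z)"
      using super_jacobi[OF x y z] by (simp add: koszul_sign_def)
    moreover have "bracket (bracket x y) z = - bracket z (bracket x y)"
      by (rule skew[OF closed[OF x y] z])
    moreover have "bracket y (bracket x z) = - bracket y (bracket z x)"
      using skew[OF x z] module_hom.neg[OF bracket_hom_right] by simp
    ultimately show ?thesis
      by simp
  qed
qed (use subspace_part in \<open>auto simp: module_hom.add[OF bracket_hom_left]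
       module_hom.add[OF bracket_hom_right] module_hom.scale[OF bracket_hom_left]
       module_hom.scale[OF bracket_hom_right]\<close>)

sublocale odd_part: lie_module scale "g 0" bracket scale "g 1" bracket
proof
  show "\<exists>S. finite S \<and> g 1 \<subseteq> span S"
    using finite_dim by auto
  show "bracket x v \<in> g 1" if "x \<in> g 0" "v \<in> g 1" for x v
    using bracket_graded[OF that] by simp
  show "bracket (bracket x y) v = bracket x (bracket y v) - bracket y (bracket x v)"
    if "x \<in> g 0" "y \<in> g 0" "v \<in> g 1" for x y v
    using super_jacobi[OF that] by (simp add: koszul_sign_def)
qed (use subspace_part in \<open>auto simp: module_hom.add[OF bracket_hom_left]
       module_hom.add[OF bracket_hom_right] module_hom.scale[OF bracket_hom_left]
       module_hom.scale[OF bracket_hom_right]\<close>)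

end

locale odd_quadratic = lie_superalgebra scale g bracket
  for scale :: "'k::field_char_0 \<Rightarrow> 'v::ab_group_add \<Rightarrow> 'v"
    and g :: "bit \<Rightarrow> 'v set"
    and bracket :: "'v \<Rightarrow> 'v \<Rightarrow> 'v" +
  fixes B :: "'v \<Rightarrow> 'v \<Rightarrow> 'k"
  assumes form_linear_left: "Vector_Spaces.linear scale (*) (\<lambda>x. B x y)"
    and form_linear_right: "Vector_Spaces.linear scale (*) (B x)"
    and supersymmetric: "x \<in> g i \<Longrightarrow> y \<in> g j \<Longrightarrow> B x y = koszul_sign i j * B y x"
    and invariant: "B (bracket x y) z = B x (bracket y z)"
    and odd_form: "x \<in> g i \<Longrightarrow> y \<in> g i \<Longrightarrow> B x y = 0"
    and nondegenerate: "(\<And>y. B x y = 0) \<Longrightarrow> x = 0"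

end

theory Submission
  imports Defs
begin

text \<open>
  Since \<open>B\<close> is odd and non-degenerate, it pairs \<open>g 0\<close> with \<open>g 1\<close> perfectly, and by invariance this
  pairing turns \<open>g 1\<close> into the coadjoint module of the Lie algebra \<open>g 0\<close>.  A coadjoint orbit is
  even-dimensional: for a functional \<open>w\<close>, the form \<open>(x, y) \<mapsto> B [x, y] w\<close> on \<open>g 0\<close> is alternating,
  and its rank is the dimension of \<open>g 0 \<cdot> w\<close>.  In particular \<open>g 0 \<cdot> w\<close> is never a line
  (\<open>odd_action_not_of_rank_one\<close>).

  In a filiform module of dimension at least two, however, the two-dimensional term of the flag is
  mapped onto its one-dimensional term, so some \<open>w\<close> in it has a line as \<open>g 0 \<cdot> w\<close>.  It remains to
  see that \<open>g 1\<close> has dimension at least two.  The perfect pairing gives this: if \<open>g 1\<close> were spanned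
  by one vector \<open>w\<close>, then \<open>x \<mapsto> B x w\<close> would embed \<open>g 0\<close> into the field
  (\<open>dim_even_le_one\<close>).
\<close>

lemma (in vector_space) dim_one_subset_span_singleton:
  assumes "dim S = 1" and "u \<in> S" and "u \<noteq> 0"
  shows "S \<subseteq> span {u}"
proof -
  obtain T where "S \<subseteq> span T" "card T = dim S"
    using basis_exists by blast
  then obtain b where S: "S \<subseteq> span {b}"
    using assms(1) by (auto simp: card_1_singleton_iff)
  then obtain c where u: "u = scale c b"
    using assms(2) by (auto simp: span_singleton)
  then have "b = scale (inverse c) u"
    using assms(3) by auto
  then have "span {b} \<subseteq> span {u}"
    by (intro span_minimal subspace_span) (auto simp: span_singleton)
  then show ?thesis
    using S by blast
qed

context odd_quadratic
begin

lemma ex_even_pairing_nonzero: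
  assumes u: "u \<in> g 1" and "u \<noteq> 0"
  shows "\<exists>y\<in>g 0. B y u \<noteq> 0"
proof -
  obtain v where v: "B u v \<noteq> 0"
    using nondegenerate \<open>u \<noteq> 0\<close> by blast
  obtain y z where y: "y \<in> g 0" and z: "z \<in> g 1" and "v = y + z"
    using parts_sum by blast
  then have "B u v = B u y + B u z"
    using Vector_Spaces.linear.axioms(3)[OF form_linear_right] module_hom.add by blast
  then have "B u y \<noteq> 0"
    using v odd_form[OF u z] by simp
  then show ?thesis
    using supersymmetric[OF u y] y by (auto simp: koszul_sign_def)
qed

lemma ex_odd_pairing_nonzero:
  assumes x: "x \<in> g 0" and "x \<noteq> 0"
  shows "\<exists>w\<in>g 1. B x w \<noteq> 0"
proof -
  obtain v where v: "B x v \<noteq> 0"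
    using nondegenerate \<open>x \<noteq> 0\<close> by blast
  obtain y w where y: "y \<in> g 0" and w: "w \<in> g 1" and "v = y + w"
    using parts_sum by blast
  then have "B x v = B x y + B x w"
    using Vector_Spaces.linear.axioms(3)[OF form_linear_right] module_hom.add by blast
  then show ?thesis
    using v odd_form[OF x y] w by auto
qed

lemma form_even_action_self:
  assumes "x \<in> g 0"
  shows "B x (bracket x w) = 0"
proof -
  have "B x (bracket x w) = B (bracket x x) w"
    by (simp add: invariant)
  also have "\<dots> = 0"
    using even_part.alternating[OF assms]
      module_hom.zero[OF Vector_Spaces.linear.axioms(3)[OF form_linear_left]] by simp
  finally show ?thesis .
qed

text \<open>
  Suppose \<open>u = bracket x w\<close> is nonzero, and write \<open>bracket y w = \<alpha> y \<cdot> u\<close> and \<open>\<beta> y = B y u\<close>.  Then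
  \<open>\<alpha> y \<cdot> \<beta> y = B y (bracket y w) = 0\<close> for all even \<open>y\<close>.  A product of two linear forms vanishes only
  if one of them does; but \<open>\<alpha> x = 1\<close>, and \<open>\<beta> \<noteq> 0\<close> by non-degeneracy.
\<close>

lemma odd_action_not_of_rank_one:
  assumes line: "\<And>y. y \<in> g 0 \<Longrightarrow> bracket y w \<in> span {bracket x w}"
    and x: "x \<in> g 0" and w: "w \<in> g 1"
  shows "bracket x w = 0"
proof (rule ccontr)
  define u where "u = bracket x w"
  assume "bracket x w \<noteq> 0"
  then obtain y where y: "y \<in> g 0" and Byu: "B y u \<noteq> 0"
    using ex_even_pairing_nonzero odd_part.act_closed[OF x w] unfolding u_def by blast
  obtain c where c: "bracket y w = scale c u"
    using line[OF y] by (auto simp: u_def span_singleton)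
  have "c * B y u = B y (bracket y w)"
    unfolding c using module_hom.scale[OF Vector_Spaces.linear.axioms(3)[OF form_linear_right]]
    by simp
  then have "c = 0"
    using form_even_action_self[OF y] Byu by simp
  \<comment> \<open>Of \<open>x\<close> and \<open>y\<close>, \<open>\<alpha>\<close> kills only \<open>y\<close> and \<open>\<beta>\<close> only \<open>x\<close>, so \<open>\<alpha>\<beta>\<close> is nonzero at \<open>x + y\<close>.\<close>
  then have "bracket (x + y) w = u"
    using c by (simp add: module_hom.add[OF bracket_hom_left] u_def)
  moreover have "B (x + y) u = B x u + B y u"
    using module_hom.add[OF Vector_Spaces.linear.axioms(3)[OF form_linear_left]] .
  moreover have "B x u = 0"
    unfolding u_def by (rule form_even_action_self[OF x])
  moreover have "x + y \<in> g 0"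
    using subspace_add[OF subspace_part x y] .
  ultimately show False
    using form_even_action_self[of "x + y" w] Byu by simp
qed

lemma dim_even_le_one:
  assumes "dim (g 1) \<le> 1"
  shows "dim (g 0) \<le> 1"
proof (cases "g 0 \<subseteq> {0}")
  case True
  then show ?thesis
    using dim_le_card[of "g 0" "{0}"] span_superset by fastforce
next
  case False
  then obtain x where x: "x \<in> g 0" "x \<noteq> 0"
    by blast
  then obtain w where w: "w \<in> g 1" and Bxw: "B x w \<noteq> 0"
    using ex_odd_pairing_nonzero by blast
  then have w0: "w \<noteq> 0"
    using module_hom.zero[OF Vector_Spaces.linear.axioms(3)[OF form_linear_right]] by auto
  obtain S where "finite S" "span S = UNIV"
    using finite_dim by blast
  moreover obtain T where T: "independent T" "g 1 \<subseteq> span T" "card T = dim (g 1)"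
    using basis_exists by blast
  \<comment> \<open>\<open>dim\<close> would also be zero on an infinite-dimensional space, hence the appeal to finiteness.\<close>
  ultimately have "finite T"
    using independent_span_bound[of S T] by simp
  moreover have "T \<noteq> {}"
    using T(2) w w0 by auto
  ultimately have "dim (g 1) \<noteq> 0"
    using T(3) by (metis card_0_eq)
  then have line: "g 1 \<subseteq> span {w}"
    using assms w w0 by (intro dim_one_subset_span_singleton) auto
  have "g 0 \<subseteq> span {x}"
  proof
    fix y assume y: "y \<in> g 0"
    define z where "z = y - scale (B y w / B x w) x"
    have "z \<in> g 0"
      unfolding z_def using x y by (intro subspace_diff subspace_scale subspace_part)
    moreover have "B z w = 0"
      unfolding z_def using Bxw
      by (simp add: module_hom.diff[OF Vector_Spaces.linear.axioms(3)[OF form_linear_left]]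
          module_hom.scale[OF Vector_Spaces.linear.axioms(3)[OF form_linear_left]])
    then have "B z v = 0" if "v \<in> g 1" for v
      using line that
      by (auto simp: span_singleton
          module_hom.scale[OF Vector_Spaces.linear.axioms(3)[OF form_linear_right]])
    ultimately have "z = 0"
      using ex_odd_pairing_nonzero by blast
    then show "y \<in> span {x}"
      by (auto simp: z_def span_singleton)
  qed
  then show ?thesis
    using dim_le_card[of "g 0" "{x}"] by simp
qed

lemma filiform_imp_dim_even_le_one:
  assumes "odd_part.filiform"
  shows "dim (g 0) \<le> 1"
proof (rule ccontr)
  assume "\<not> dim (g 0) \<le> 1"
  then have dim: "2 \<le> dim (g 1)"
    using dim_even_le_one by linarith
  obtain W where
    W: "\<forall>i \<le> dim (g 1). odd_part.submodule (W i) \<and> dim (W i) = i"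
    and step: "\<forall>i \<in> {1..dim (g 1)}.
      W (i - 1) \<subset> W i \<and> odd_part.act_span (W i) = W (i - 1)"
    using assms unfolding odd_part.filiform_def by (elim exE conjE)
  have act: "odd_part.act_span (W 2) = W 1"
    using bspec[OF step, of 2] dim by simp
  have dim1: "dim (W 1) = 1"
    using W dim by simp
  have sub: "W 2 \<subseteq> g 1"
    using W dim by (simp add: odd_part.submodule_def)
  have in_W1: "bracket x w \<in> W 1" if "x \<in> g 0" "w \<in> W 2" for x w
    unfolding act[symmetric] odd_part.act_span_def using that by (intro span_base) blast
  have "bracket x w = 0" if x: "x \<in> g 0" and w: "w \<in> W 2" for x w
  proof (rule ccontr)
    assume nz: "bracket x w \<noteq> 0"
    then have "W 1 \<subseteq> span {bracket x w}"
      using dim_one_subset_span_singleton[OF dim1 in_W1[OF x w]] by blast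
    then have "bracket x w = 0"
      using in_W1 w sub by (intro odd_action_not_of_rank_one x) auto
    with nz show False ..
  qed
  then have "W 1 \<subseteq> span {0}"
    unfolding act[symmetric] odd_part.act_span_def by (intro span_mono) auto
  then have "W 1 \<subseteq> span {}"
    by simp
  then have "dim (W 1) \<le> 0"
    using dim_le_card[of "W 1" "{}"] by simp
  with dim1 show False
    by simp
qed

end

theorem theorem2p1:
  shows "\<not> (\<exists>(scale :: 'k::{alg_closed_field, field_char_0} \<Rightarrow> 'v::ab_group_add \<Rightarrow> 'v)
              (g :: bit \<Rightarrow> 'v set) (bracket :: 'v \<Rightarrow> 'v \<Rightarrow> 'v) (B :: 'v \<Rightarrow> 'v \<Rightarrow> 'k).
            odd_quadratic scale g bracket B \<and>
            lie_module.filiform (g 0) scale (g 1) bracket \<and>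
            vector_space.dim scale (g 0) \<ge> 2)"
proof (clarify)
  fix scale :: "'k \<Rightarrow> 'v \<Rightarrow> 'v" and g bracket and B :: "'v \<Rightarrow> 'v \<Rightarrow> 'k"
  assume "odd_quadratic scale g bracket B"
    and filiform: "lie_module.filiform (g 0) scale (g 1) bracket"
    and dim: "vector_space.dim scale (g 0) \<ge> 2"
  then interpret odd_quadratic scale g bracket B
    by blast
  show False
    using filiform_imp_dim_even_le_one[OF filiform] dim by linarith
qed

end
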